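(* If $G$ is a $\mathcal{T}_2$-graph, then the $4$-independence complex $\mathrm{Ind}_4(G)$ is shellable.
   Context: All graphs are finite and simple. A block of a graph is a maximal connected subgraph that remains connected after removal of any single vertex; $G$ is a block graph if every block is a complete graph (a clique). An $n$-clique path $\mathrm{CP}(B_1,\dots,B_n)$ ($n\ge 1$) is a graph consisting of cliques $B_1,\dots,B_n$ arranged linearly, where each consecutive pair $B_i, B_{i+1}$ shares exactly one vertex $x_i$; $x_1,\dots,x_{n-1}$ are its connecting vertices. A connected graph $H$ is a $\mathcal{T}_2$-graph if it is a block graph and contains a clique-path subgraph $P = \mathrm{CP}(B_1,\dots,B_n)$, $n \ge 1$, of maximum length, with connecting vertices $x_i \in B_i \cap B_{i+1}$ ($1 \le i \le n-1$), such that every clique (block) $K$ of $H$ not belonging to $P$ satisfies one of: (1) $V(K)\cap V(P) = \{x_i\}$ for some $1 \le i \le n-1$; or (2) $V(K)\cap V(P) = \emptyset$ and there is a clique $K'$ of $H$ satisfying (1) with $V(K)\cap V(K') = \{y\}$ for some vertex $y$. A graph is a $\mathcal{T}_2$-graph if each of its connected components is. For $r \geq 1$, a subset $A \subseteq V(G)$ is $r$-independent if every connected component of $G[A]$ has at most $r$ vertices; $\mathrm{Ind}_r(G)$ is the simplicial complex on $V(G)$ of all $r$-independent subsets. A (not necessarily pure) simplicial complex is shellable if its facets can be ordered $F_1,\dots,F_t$ so that for each $k>1$, $\langle F_k\rangle \cap \langle F_1,\dots,F_{k-1}\rangle$ is pure of dimension $\dim F_k-1$ ($\langle\mathcal F\rangle$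 = complex generated by $\mathcal F$). *)

theory Defs
  imports "Graph_Theory.Graph_Theory"
begin

text \<open>
  Finite simple graphs are the symmetric digraphs of the locale \<open>graph\<close> (finite, no loops, no
  parallel arcs). On such graphs \<open>sccs\<close> is the set of connected components.
\<close>

text \<open>
  Library connectedness requires a vertex. The empty graph left after deleting the only vertex of
  a one-vertex graph has to be accepted here, so that an isolated vertex is a block.
\<close>

definition no_cutvertex :: "('a,'b) pre_digraph \<Rightarrow> bool" where
  "no_cutvertex B \<longleftrightarrow>
     (\<forall>v\<in>verts B. verts B = {v} \<or> connected (pre_digraph.del_vert B v))"

definition blocks :: "('a,'b) pre_digraph \<Rightarrow> ('a,'b) pre_digraph set" where
  "blocks G = {B. pre_digraph.max_subgraph G (\<lambda>B. connected B \<and> no_cutvertex B) B}"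

definition clique :: "('a,'b) pre_digraph \<Rightarrow> bool" where
  "clique B \<longleftrightarrow> verts B \<noteq> {} \<and> complete_digraph (card (verts B)) B"

definition block_graph :: "('a,'b) pre_digraph \<Rightarrow> bool" where
  "block_graph G \<longleftrightarrow> (\<forall>B\<in>blocks G. clique B)"

text \<open>
  The linear arrangement means that cliques which are not consecutive are disjoint; in particular
  the connecting vertices are pairwise distinct. The list index starts at 0.
\<close>

definition clique_path :: "('a,'b) pre_digraph list \<Rightarrow> bool" where
  "clique_path Bs \<longleftrightarrow>
     Bs \<noteq> [] \<and> distinct Bs \<and> (\<forall>B\<in>set Bs. clique B) \<and>
     (\<forall>i. Suc i < length Bs \<longrightarrow> (\<exists>x. verts (Bs ! i) \<inter> verts (Bs ! Suc i) = {x})) \<and>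
     (\<forall>i j. Suc i < j \<and> j < length Bs \<longrightarrow> verts (Bs ! i) \<inter> verts (Bs ! j) = {})"

definition cp_verts :: "('a,'b) pre_digraph list \<Rightarrow> 'a set" where
  "cp_verts Bs = (\<Union>B\<in>set Bs. verts B)"

definition connecting_verts :: "('a,'b) pre_digraph list \<Rightarrow> 'a set" where
  "connecting_verts Bs =
     {x. \<exists>i. Suc i < length Bs \<and> verts (Bs ! i) \<inter> verts (Bs ! Suc i) = {x}}"

text \<open>
  Inside a block graph the cliques of a clique path are blocks of the graph. With arbitrary
  subcliques, a complete graph would contain every path on its vertices as a clique path of
  single edges.
\<close>

definition clique_path_in :: "('a,'b) pre_digraph \<Rightarrow> ('a,'b) pre_digraph list \<Rightarrow> bool" where
  "clique_path_in H Bs \<longleftrightarrow> clique_path Bs \<and> set Bs \<subseteq> blocks H"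

definition longest_clique_path_in :: "('a,'b) pre_digraph \<Rightarrow> ('a,'b) pre_digraph list \<Rightarrow> bool" where
  "longest_clique_path_in H Bs \<longleftrightarrow>
     clique_path_in H Bs \<and> (\<forall>Cs. clique_path_in H Cs \<longrightarrow> length Cs \<le> length Bs)"

definition attached_to_path :: "('a,'b) pre_digraph list \<Rightarrow> ('a,'b) pre_digraph \<Rightarrow> bool" where
  "attached_to_path Bs K \<longleftrightarrow> (\<exists>x\<in>connecting_verts Bs. verts K \<inter> cp_verts Bs = {x})"

definition connected_T2_graph :: "('a,'b) pre_digraph \<Rightarrow> bool" where
  "connected_T2_graph H \<longleftrightarrow>
     connected H \<and> block_graph H \<and>
     (\<exists>Bs. longest_clique_path_in H Bs \<and>
        (\<forall>K\<in>blocks H. K \<notin> set Bs \<longrightarrow>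
           attached_to_path Bs K \<or>
           verts K \<inter> cp_verts Bs = {} \<and>
             (\<exists>K'\<in>blocks H. attached_to_path Bs K' \<and> (\<exists>y. verts K \<inter> verts K' = {y}))))"

definition T2_graph :: "('a,'b) pre_digraph \<Rightarrow> bool" where
  "T2_graph G \<longleftrightarrow> (\<forall>H\<in>pre_digraph.sccs G. connected_T2_graph H)"

definition r_independent :: "nat \<Rightarrow> ('a,'b) pre_digraph \<Rightarrow> 'a set \<Rightarrow> bool" where
  "r_independent r G A \<longleftrightarrow>
     A \<subseteq> verts G \<and> (\<forall>C\<in>pre_digraph.sccs (G \<restriction> A). card (verts C) \<le> r)"

definition Ind :: "nat \<Rightarrow> ('a,'b) pre_digraph \<Rightarrow> 'a set set" where
  "Ind r G = {A. r_independent r G A}"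

text \<open>A finite simplicial complex is given by its set of faces, including the empty face.\<close>

definition facets :: "'a set set \<Rightarrow> 'a set set" where
  "facets \<Delta> = {F\<in>\<Delta>. \<forall>F'\<in>\<Delta>. F \<subseteq> F' \<longrightarrow> F' = F}"

definition generated :: "'a set set \<Rightarrow> 'a set set" where
  "generated \<F> = (\<Union>F\<in>\<F>. Pow F)"

definition face_dim :: "'a set \<Rightarrow> int" where
  "face_dim F = int (card F) - 1"

definition pure_of_dim :: "'a set set \<Rightarrow> int \<Rightarrow> bool" where
  "pure_of_dim \<Delta> d \<longleftrightarrow> \<Delta> \<noteq> {} \<and> (\<forall>F\<in>facets \<Delta>. face_dim F = d)"

definition shellable :: "'a set set \<Rightarrow> bool" where
  "shellable \<Delta> \<longleftrightarrow>
     (\<exists>Fs. distinct Fs \<and> set Fs = facets \<Delta> \<and>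
        (\<forall>k. 0 < k \<and> k < length Fs \<longrightarrow>
           pure_of_dim (generated {Fs ! k} \<inter> generated (set (take k Fs)))
             (face_dim (Fs ! k) - 1)))"

end

theory Submission
  imports Defs
begin

text \<open>
  The complex is vertex decomposable in the sense of Bjorner and Wachs, hence shellable: if the faces
  must contain a given \<open>r\<close>-independent set \<open>D\<close> and the vertex set itself is not \<open>r\<close>-independent,
  some vertex \<open>v\<close> outside \<open>D\<close> is shedding, that is, in every face containing \<open>v\<close> and \<open>D\<close> the vertex \<open>v\<close> can be exchanged for a vertex not in the face. One then shells first the
  facets avoiding \<open>v\<close> (delete \<open>v\<close> from the graph), then those containing \<open>v\<close> (add \<open>v\<close> to \<open>D\<close>). The
  vertex \<open>v\<close> is chosen as one behind which as many vertices as possible, within a smallest large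
  component, are separated from the rest of the graph. Block graphs enter through the property that
  two vertices of a component are adjacent unless a third one separates them.
\<close>

section \<open>Shellings\<close>

text \<open>The exchange form of a shelling: the intersection of \<open>Fs ! k\<close> with any
  earlier set lies in some \<open>Fs ! k - {w}\<close> that an earlier set covers. It speaks of
  lists of arbitrary sets, so that shellings of two families can be concatenated.\<close>

definition shelling :: "'b set list \<Rightarrow> bool" where
  "shelling Fs \<longleftrightarrow> distinct Fs \<and>
     (\<forall>k<length Fs. \<forall>j<k. \<exists>w\<in>Fs ! k - Fs ! j. \<exists>i<k. Fs ! k - {w} \<subseteq> Fs ! i)"

text \<open>Two positions in the same list keep their witnesses, shifted by \<open>length xs\<close>
  inside \<open>ys\<close>; \<open>cross\<close> serves a set of \<open>ys\<close> against a set of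
  \<open>xs\<close>.\<close>

lemma shelling_append:
  assumes xs: "shelling xs" and ys: "shelling ys" and disj: "set xs \<inter> set ys = {}"
    and cross: "\<And>x y. x \<in> set xs \<Longrightarrow> y \<in> set ys \<Longrightarrow> \<exists>w\<in>y - x. \<exists>x'\<in>set xs. y - {w} \<subseteq> x'"
  shows "shelling (xs @ ys)"
proof -
  have "\<exists>w\<in>(xs @ ys) ! k - (xs @ ys) ! j. \<exists>i<k. (xs @ ys) ! k - {w} \<subseteq> (xs @ ys) ! i"
    if k: "k < length (xs @ ys)" and j: "j < k" for k j
  proof (cases "k < length xs")
    case True
    then obtain w i where "w \<in> xs ! k - xs ! j" "i < k" "xs ! k - {w} \<subseteq> xs ! i"
      using xs j unfolding shelling_def by meson
    then show ?thesis using True j by (intro bexI[of _ w] exI[of _ i]) (auto simp: nth_append)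
  next
    case k_ge: False
    define k' where "k' = k - length xs"
    have k': "k' < length ys" "(xs @ ys) ! k = ys ! k'"
      using k k_ge by (auto simp: k'_def nth_append)
    show ?thesis
    proof (cases "j < length xs")
      case True
      then obtain w x' where w: "w \<in> ys ! k' - xs ! j" "x' \<in> set xs" "ys ! k' - {w} \<subseteq> x'"
        using cross[of "xs ! j" "ys ! k'"] k' by auto
      then obtain i where "i < length xs" "x' = xs ! i" by (metis in_set_conv_nth)
      then show ?thesis
        using w k' True k_ge by (intro bexI[of _ w] exI[of _ i]) (auto simp: nth_append)
    next
      case False
      define j' where "j' = j - length xs"
      have j': "j' < k'" "(xs @ ys) ! j = ys ! j'"
        using False j by (auto simp: j'_def k'_def nth_append)
      then obtain w i where "w \<in> ys ! k' - ys ! j'" "i < k'" "ys ! k' - {w} \<subseteq> ys ! i"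
        using ys k' unfolding shelling_def by meson
      then show ?thesis
        using k' j' k_ge
        by (intro bexI[of _ w] exI[of _ "length xs + i"]) (auto simp: nth_append k'_def)
    qed
  qed
  then show ?thesis using xs ys disj by (auto simp: shelling_def)
qed

text \<open>A facet of the intersection lies in some \<open>Fs ! k - {w}\<close>, which is itself a
  face of the intersection; by maximality the two are equal.\<close>

lemma shellableI:
  assumes fin: "\<And>F. F \<in> \<Delta> \<Longrightarrow> finite F" and Fs: "shelling Fs" "set Fs = facets \<Delta>"
  shows "shellable \<Delta>"
proof -
  have "pure_of_dim (generated {Fs ! k} \<inter> generated (set (take k Fs))) (face_dim (Fs ! k) - 1)"
    if k: "0 < k" "k < length Fs" for k
  proof -
    let ?X = "generated {Fs ! k} \<inter> generated (set (take k Fs))"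
    have in_X: "F \<in> ?X \<longleftrightarrow> F \<subseteq> Fs ! k \<and> (\<exists>j<k. F \<subseteq> Fs ! j)" for F
      using nth_image[of k Fs, symmetric] k by (auto simp: generated_def)
    have "Fs ! k \<in> facets \<Delta>" using Fs(2) k nth_mem by blast
    then have fin_k: "finite (Fs ! k)" using fin by (auto simp: facets_def)
    have "face_dim F = face_dim (Fs ! k) - 1" if F: "F \<in> facets ?X" for F
    proof -
      have "F \<in> ?X" and F_max: "\<And>F'. F' \<in> ?X \<Longrightarrow> F \<subseteq> F' \<Longrightarrow> F' = F"
        using F unfolding facets_def by blast+
      then obtain j where j: "F \<subseteq> Fs ! k" "j < k" "F \<subseteq> Fs ! j"
        using iffD1[OF in_X \<open>F \<in> ?X\<close>] by auto
      then obtain w i where w: "w \<in> Fs ! k - Fs ! j" "i < k" "Fs ! k - {w} \<subseteq> Fs ! i"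
        using Fs(1) k unfolding shelling_def by meson
      have "Fs ! k - {w} \<in> ?X" by (rule iffD2[OF in_X]) (use w(2,3) in auto)
      moreover have "F \<subseteq> Fs ! k - {w}" using w j by blast
      ultimately have "F = Fs ! k - {w}" using F_max by metis
      \<comment> \<open>Positivity keeps the natural number \<open>card (Fs ! k) - 1\<close> from
        being truncated.\<close>
      moreover have "0 < card (Fs ! k)" using fin_k w(1) card_gt_0_iff by blast
      ultimately show ?thesis using w(1) fin_k by (simp add: face_dim_def of_nat_diff)
    qed
    moreover have "{} \<in> ?X" by (rule iffD2[OF in_X]) (use k in auto)
    ultimately show ?thesis unfolding pure_of_dim_def by auto
  qed
  then show ?thesis using Fs by (auto simp: shellable_def shelling_def)
qed

section \<open>Connectivity and separating vertices\<close>

locale adjacency =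
  fixes E :: "'a \<Rightarrow> 'a \<Rightarrow> bool"
  assumes adj_sym: "E x y \<Longrightarrow> E y x"
begin

text \<open>With the vertex set as a parameter, deleting a vertex is the set difference
  \<open>X - {c}\<close> and no new graph has to be formed.\<close>

inductive conn :: "'a set \<Rightarrow> 'a \<Rightarrow> 'a \<Rightarrow> bool" for X where
  conn_refl: "a \<in> X \<Longrightarrow> conn X a a"
| conn_step: "conn X a b \<Longrightarrow> E b c \<Longrightarrow> c \<in> X \<Longrightarrow> conn X a c"

definition comp_of :: "'a set \<Rightarrow> 'a \<Rightarrow> 'a set" where
  "comp_of X a = {b. conn X a b}"

lemma conn_in: "conn X a b \<Longrightarrow> a \<in> X \<and> b \<in> X"
  by (induction rule: conn.induct) auto

lemma conn_mono: "conn X a b \<Longrightarrow> X \<subseteq> Y \<Longrightarrow> conn Y a b"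
  by (induction rule: conn.induct) (auto intro: conn.intros)

lemma conn_adj: "E a b \<Longrightarrow> a \<in> X \<Longrightarrow> b \<in> X \<Longrightarrow> conn X a b"
  by (auto intro: conn.intros)

lemma conn_trans: "conn X a b \<Longrightarrow> conn X b c \<Longrightarrow> conn X a c"
  by (rotate_tac, induction rule: conn.induct) (auto intro: conn.intros)

lemma conn_sym: "conn X a b \<Longrightarrow> conn X b a"
proof (induction rule: conn.induct)
  case (conn_step a b c)
  then show ?case
    by (meson adj_sym conn_adj conn_in conn_trans)
qed (auto intro: conn.intros)

lemma conn_common: "conn X a b \<Longrightarrow> conn X a c \<Longrightarrow> conn X b c"
  using conn_sym conn_trans by blast

lemma conn_within:
  "conn X a b \<Longrightarrow> (\<And>z. conn X a z \<Longrightarrow> z \<in> Y) \<Longrightarrow> conn Y a b"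
proof (induction rule: conn.induct)
  case (conn_step a b c)
  then show ?case by (meson conn.conn_step)
qed (auto intro: conn.intros)

lemma conn_comp_of: "conn X a b \<Longrightarrow> conn (comp_of X a) a b"
  by (erule conn_within) (simp add: comp_of_def)

lemma comp_of_subset: "comp_of X a \<subseteq> X"
  using conn_in by (auto simp: comp_of_def)

lemma comp_of_mono: "X \<subseteq> Y \<Longrightarrow> comp_of X a \<subseteq> comp_of Y a"
  using conn_mono by (auto simp: comp_of_def)

lemma comp_of_eq: "conn X a b \<Longrightarrow> comp_of X a = comp_of X b"
  unfolding comp_of_def using conn_sym conn_trans by blast

text \<open>The walk is cut at its first arrival at \<open>c\<close>; \<open>w\<close> is the vertex
  just before it.\<close>

lemma conn_exit:
  "conn X a b \<Longrightarrow> \<not> conn (X - {c}) a b \<Longrightarrow> a \<noteq> c \<Longrightarrow> c \<in> X \<and> (\<exists>w. E w c \<and> conn (X - {c}) a w)"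
proof (induction rule: conn.induct)
  case (conn_refl a)
  then show ?case by (auto intro: conn.intros)
next
  case (conn_step a b d)
  show ?case
  proof (cases "conn (X - {c}) a b")
    case True
    then have "d = c"
      using conn_step.hyps conn_step.prems by (auto intro: conn.intros)
    then show ?thesis using True conn_step.hyps by blast
  qed (use conn_step in blast)
qed

lemma conn_exit_conn:
  assumes "conn X a b" "\<not> conn (X - {c}) a b"
  shows "conn X a c"
proof (cases "a = c")
  case True
  then show ?thesis using assms conn_in conn_refl by blast
next
  case False
  then obtain w where "c \<in> X" "E w c" "conn (X - {c}) a w"
    using conn_exit assms by blast
  then show ?thesis by (meson Diff_subset conn_mono conn_step)
qed

text \<open>The walk from \<open>a\<close> up to its first arrival at \<open>c\<close> cannot
  contain \<open>b\<close>, since otherwise \<open>a\<close> would reach \<open>b\<close> without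
  \<open>c\<close>.\<close>

lemma conn_avoid:
  assumes "conn X a b" "\<not> conn (X - {c}) a b" "b \<noteq> c"
  shows "conn (X - {b}) a c"
proof (cases "a = c")
  case True
  then show ?thesis using assms conn_in[OF assms(1)] by (auto intro: conn_refl)
next
  case False
  then obtain w where w: "c \<in> X" "E w c" "conn (X - {c}) a w"
    using conn_exit assms by blast
  then have "conn (X - {c} - {b}) a w"
    using conn_exit_conn assms(2) by blast
  then have "conn (X - {b}) a w" by (rule conn_mono) blast
  then show ?thesis using w assms(3) by (blast intro: conn_step)
qed

text \<open>
  On the vertex set of a graph this says that the graph is a block graph. In contrast to the
  definition by maximal subgraphs, it visibly passes to induced subgraphs.
\<close>

definition separable :: "'a set \<Rightarrow> bool" where
  "separable V \<longleftrightarrow>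
     (\<forall>a b. conn V a b \<longrightarrow> a \<noteq> b \<longrightarrow> \<not> E a b \<longrightarrow>
        (\<exists>z. z \<noteq> a \<and> z \<noteq> b \<and> \<not> conn (V - {z}) a b))"

lemma separable_subset: "separable V \<Longrightarrow> W \<subseteq> V \<Longrightarrow> separable W"
  unfolding separable_def by (meson Diff_mono conn_mono subset_refl)

text \<open>No third vertex separates \<open>a\<close> from \<open>b\<close>: removing
  \<open>c\<close> does not by assumption, and removing any other vertex leaves the path through
  \<open>c\<close>. So separability forces the edge.\<close>

lemma separable_adj:
  assumes "separable V" "conn (V - {c}) a b" "E a c" "E b c" "a \<noteq> b" "c \<in> V"
  shows "E a b"
proof (rule ccontr)
  assume "\<not> E a b"
  moreover have "conn V a b" using assms(2) conn_mono by blast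
  ultimately obtain z where z: "z \<noteq> a" "z \<noteq> b" "\<not> conn (V - {z}) a b"
    using assms(1,5) unfolding separable_def by blast
  then have "z \<noteq> c" using assms(2) by blast
  then have "conn (V - {z}) a c" "conn (V - {z}) c b"
    using z assms conn_in[OF assms(2)] by (auto intro!: conn_adj dest: adj_sym)
  then show False using z conn_trans by blast
qed

text \<open>Induction on the number of separators of \<open>a\<close> and \<open>b\<close>: one of
  them, \<open>z\<close>, splits the pair into \<open>a\<close>, \<open>z\<close> and
  \<open>z\<close>, \<open>b\<close>, and every separator of these pairs already separates
  \<open>a\<close> from \<open>b\<close>.\<close>

lemma conn_by_separators:
  assumes "finite V" "separable V" "conn V a b"
    and "\<And>z. z \<noteq> a \<Longrightarrow> z \<noteq> b \<Longrightarrow> \<not> conn (V - {z}) a b \<Longrightarrow> z \<in> D"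
  shows "conn (insert a (insert b D)) a b"
  using assms(3,4)
proof (induction "card {z\<in>V. z \<noteq> a \<and> z \<noteq> b \<and> \<not> conn (V - {z}) a b}" arbitrary: a b rule: less_induct)
  case less
  let ?S = "\<lambda>a b. {z\<in>V. z \<noteq> a \<and> z \<noteq> b \<and> \<not> conn (V - {z}) a b}"
  show ?case
  proof (cases "a = b \<or> E a b")
    case True
    then show ?thesis by (auto intro: conn_refl conn_adj)
  next
    case False
    then obtain z where z: "z \<noteq> a" "z \<noteq> b" "\<not> conn (V - {z}) a b"
      using less.prems assms(2) unfolding separable_def by blast
    have az: "conn V a z" and zb: "conn V b z"
      using conn_exit_conn less.prems(1) z(3) conn_sym by blast+
    have *: "s \<noteq> a \<and> s \<noteq> b \<and> \<not> conn (V - {s}) a b" if "s \<noteq> a \<and> s \<noteq> z \<and> \<not> conn (V - {s}) a z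
       \<or> s \<noteq> z \<and> s \<noteq> b \<and> \<not> conn (V - {s}) z b" for s
    proof -
      have "s \<noteq> z" using that by blast
      have "\<not> conn (V - {s}) a b"
      proof
        assume c: "conn (V - {s}) a b"
        moreover have "\<not> conn (V - {s} - {z}) a b"
          using z(3) conn_mono[of "V - {s} - {z}" a b "V - {z}"] by blast
        moreover have "\<not> conn (V - {s} - {z}) b a"
          using calculation conn_sym by blast
        ultimately have "conn (V - {s}) a z" "conn (V - {s}) b z"
          using conn_exit_conn conn_sym by blast+
        then show False using that conn_sym by blast
      qed
      moreover have "s \<noteq> a" "s \<noteq> b"
        using that conn_sym conn_avoid[OF less.prems(1) z(3)]
          conn_avoid[OF conn_sym[OF less.prems(1)], of z] z by blast+
      ultimately show ?thesis by blast
    qed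
    \<comment> \<open>\<open>z\<close> separates \<open>a\<close> from \<open>b\<close> but is an
      end of both smaller pairs, so the counts drop strictly.\<close>
    have "z \<in> ?S a b" using z az conn_in by blast
    moreover have "?S a z \<subseteq> ?S a b - {z}" "?S z b \<subseteq> ?S a b - {z}" using * by blast+
    ultimately have "?S a z \<subset> ?S a b" "?S z b \<subset> ?S a b" by blast+
    then have less2: "card (?S a z) < card (?S a b)" "card (?S z b) < card (?S a b)"
      using assms(1) by (auto intro!: psubset_card_mono)
    have "z \<in> D" using z less.prems(2) by blast
    have "conn (insert a (insert z D)) a z"
      by (rule less.hyps[OF less2(1) az]) (use * less.prems(2) in blast)
    then have 1: "conn (insert a (insert b D)) a z"
      by (rule conn_mono) (use \<open>z \<in> D\<close> in blast)
    have "conn (insert z (insert b D)) z b"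
      by (rule less.hyps[OF less2(2) conn_sym[OF zb]]) (use * less.prems(2) in blast)
    then have "conn (insert a (insert b D)) z b"
      by (rule conn_mono) (use \<open>z \<in> D\<close> in blast)
    with 1 show ?thesis by (rule conn_trans)
  qed
qed

text \<open>A walk can leave the component only through \<open>z\<close> and must return through
  \<open>z\<close>, so its excursions can be cut out.\<close>

lemma conn_comp_insert:
  assumes "p \<in> insert z (comp_of (X - {z}) a)" "q \<in> insert z (comp_of (X - {z}) a)"
    and "conn Y p q" "Y \<subseteq> X" "z \<in> Y"
  shows "conn (insert z (comp_of (X - {z}) a) \<inter> Y) p q"
proof -
  let ?C = "insert z (comp_of (X - {z}) a) \<inter> Y"
  have inC: "conn ?C x y" if "x \<in> insert z (comp_of (X - {z}) a)" "conn (Y - {z}) x y" for x y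
  proof (rule conn_within[OF that(2)])
    fix t assume t: "conn (Y - {z}) x t"
    then have "conn (X - {z}) x t" by (rule conn_mono) (use assms(4) in blast)
    moreover from this have "x \<noteq> z" using conn_in by blast
    ultimately have "t \<in> comp_of (X - {z}) a"
      using that(1) conn_trans by (auto simp: comp_of_def)
    then show "t \<in> ?C" using conn_in[OF t] by blast
  qed
  show ?thesis
  proof (cases "conn (Y - {z}) p q")
    case True
    then show ?thesis using inC assms(1) by blast
  next
    case False
    have toz: "conn ?C x z" if x: "x \<in> insert z (comp_of (X - {z}) a)" and xy: "conn Y x y"
      "\<not> conn (Y - {z}) x y" for x y
    proof (cases "x = z")
      case True
      then show ?thesis using assms(5) by (auto intro: conn_refl)
    next
      case False
      then obtain w where "E w z" "conn (Y - {z}) x w"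
        using conn_exit[OF xy] by blast
      then show ?thesis using inC[OF x] assms(5) by (blast intro: conn_step)
    qed
    have "\<not> conn (Y - {z}) q p" using False conn_sym by blast
    then have "conn ?C q z" by (rule toz[OF assms(2) conn_sym[OF assms(3)]])
    then have "conn ?C z q" by (rule conn_sym)
    with toz[OF assms(1,3) False] show ?thesis by (rule conn_trans)
  qed
qed

text \<open>For \<open>z\<close> in \<open>S\<close>, a component of \<open>S - {z}\<close> that
  contains \<open>u\<close> or \<open>w\<close>, with \<open>z\<close> added back, still joins
  \<open>u\<close> and \<open>w\<close> inseparably. By minimality it is all of \<open>S\<close>, so
  \<open>S - {z}\<close> is a single component.\<close>

lemma minimal_inseparable_connected:
  assumes "conn S u w" "u \<noteq> w"
    and insep: "\<And>z. z \<noteq> u \<Longrightarrow> z \<noteq> w \<Longrightarrow> conn (S - {z}) u w"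
    and minimal: "\<And>S'. S' \<subset> S \<Longrightarrow> conn S' u w \<Longrightarrow> \<exists>z. z \<noteq> u \<and> z \<noteq> w \<and> \<not> conn (S' - {z}) u w"
    and xy: "x \<in> S - {z}" "y \<in> S - {z}"
  shows "conn (S - {z}) x y"
proof (cases "z \<in> S")
  case True
  \<comment> \<open>One of the two ends that survives the deletion of \<open>z\<close>.\<close>
  define a where "a = (if z = u then w else u)"
  have a: "a \<in> S - {z}" using assms(2) conn_in[OF assms(1)] by (auto simp: a_def)
  let ?S = "insert z (comp_of (S - {z}) a)"
  have uw: "u \<in> ?S" "w \<in> ?S"
    using insep[of z] a conn_in[OF assms(1)]
    by (auto simp: a_def comp_of_def intro: conn_refl)
  have sub: "?S \<subseteq> S" using True comp_of_subset[of "S - {z}" a] by blast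
  have "conn (?S - {s}) u w" if "s \<noteq> u" "s \<noteq> w" for s
  proof (cases "s = z")
    case True
    then have "conn (S - {z}) u w" "a = u" using insep that by (auto simp: a_def)
    then show ?thesis
      by (intro conn_within[OF \<open>conn (S - {z}) u w\<close>]) (use True conn_in in \<open>auto simp: comp_of_def\<close>)
  next
    case False
    then have "conn (?S \<inter> (S - {s})) u w"
      using conn_comp_insert[OF uw insep] True that by blast
    then show ?thesis by (rule conn_mono) blast
  qed
  moreover have "conn ?S u w"
    using conn_comp_insert[OF uw assms(1) order_refl True] by (rule conn_mono) blast
  ultimately have "\<not> ?S \<subset> S" using minimal by blast
  then have "S - {z} = comp_of (S - {z}) a"
    using comp_of_subset[of "S - {z}" a] sub by blast
  then have "conn (S - {z}) a x" "conn (S - {z}) a y" using xy by (auto simp: comp_of_def)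
  then show ?thesis using conn_sym conn_trans by blast
next
  case False
  have "conn (comp_of S u - {s}) u w" if "s \<noteq> u" "s \<noteq> w" for s
    using insep[OF that]
  proof (rule conn_within)
    fix t assume t: "conn (S - {s}) u t"
    then have "conn S u t" by (rule conn_mono) blast
    then show "t \<in> comp_of S u - {s}" using conn_in[OF t] by (simp add: comp_of_def)
  qed
  then have "\<not> comp_of S u \<subset> S" using minimal conn_comp_of[OF assms(1)] by blast
  then have "comp_of S u = S" using comp_of_subset by blast
  then have "conn S u x" "conn S u y" using xy by (auto simp: comp_of_def)
  then show ?thesis using conn_sym conn_trans False by (metis Diff_insert0 Diff_empty)
qed

section \<open>Shedding vertices\<close>

definition bounded_comps :: "nat \<Rightarrow> 'a set \<Rightarrow> bool" where
  "bounded_comps r A \<longleftrightarrow> (\<forall>a\<in>A. card (comp_of A a) \<le> r)"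

lemma finite_comp_of: "finite X \<Longrightarrow> finite (comp_of X a)"
  using comp_of_subset finite_subset by blast

lemma card_comp_of_mono:
  assumes "card (comp_of Y u) \<le> r" "X \<subseteq> Y" "finite Y"
  shows "card (comp_of X u) \<le> r"
  using card_mono[OF finite_comp_of[OF assms(3)] comp_of_mono[OF assms(2)]] assms(1)
  by (rule le_trans)

lemma bounded_comps_subset:
  "bounded_comps r A \<Longrightarrow> B \<subseteq> A \<Longrightarrow> finite A \<Longrightarrow> bounded_comps r B"
  unfolding bounded_comps_def by (blast intro: card_comp_of_mono)

text \<open>Components that miss \<open>u\<close> lie inside components of \<open>A\<close>, so only
  the component of \<open>u\<close> has to be measured after an exchange.\<close>

lemma bounded_comps_insert:
  assumes "bounded_comps r A" "finite A" "X \<subseteq> insert u A" "card (comp_of X u) \<le> r"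
  shows "bounded_comps r X"
  unfolding bounded_comps_def
proof
  fix b assume b: "b \<in> X"
  show "card (comp_of X b) \<le> r"
  proof (cases "conn X b u")
    case True
    then show ?thesis using assms(4) comp_of_eq by simp
  next
    case False
    then have "comp_of X b \<subseteq> A"
      using comp_of_subset assms(3) by (auto simp: comp_of_def dest: conn_in)
    then have "comp_of X b \<subseteq> comp_of A b"
      unfolding comp_of_def using conn_within by blast
    then have "card (comp_of X b) \<le> card (comp_of A b)"
      by (intro card_mono finite_comp_of assms)
    also have "\<dots> \<le> r"
      using False b assms by (metis bounded_comps_def conn_refl insertE subsetD)
    finally show ?thesis .
  qed
qed

section \<open>Vertices cut off from a root\<close>

text \<open>
  For \<open>y \<noteq> v\<close>, \<open>beyond V v y\<close> is \<open>y\<close> together with everything that \<open>y\<close> separates from \<open>v\<close>.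
\<close>

definition beyond :: "'a set \<Rightarrow> 'a \<Rightarrow> 'a \<Rightarrow> 'a set" where
  "beyond V v y = {t. conn V t v \<and> \<not> conn (V - {y}) t v}"

lemma beyond_self: "conn V y v \<Longrightarrow> y \<in> beyond V v y"
  using conn_in[of "V - {y}" y v] by (auto simp: beyond_def)

lemma beyond_closed:
  assumes t: "t \<in> beyond V v y" and ts: "conn (V - {y}) t s"
  shows "s \<in> beyond V v y"
proof -
  have st: "conn (V - {y}) s t" using ts by (rule conn_sym)
  then have "conn V s t" by (rule conn_mono) blast
  then have "conn V s v" using t conn_trans by (simp add: beyond_def)
  moreover have "\<not> conn (V - {y}) s v"
    using t conn_trans[OF ts, of v] by (auto simp: beyond_def)
  ultimately show ?thesis by (simp add: beyond_def)
qed

text \<open>A walk from \<open>t\<close> to \<open>v\<close> must meet \<open>y\<close>; up to its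
  first arrival there it avoids \<open>y\<close> and so stays in the set by
  \<open>beyond_closed\<close>.\<close>

lemma beyond_connected:
  assumes "t \<in> beyond V v y"
  shows "conn (beyond V v y) t y"
proof (cases "t = y")
  case True
  then show ?thesis using assms by (simp add: conn_refl)
next
  case False
  have "conn V t v" "\<not> conn (V - {y}) t v" using assms by (auto simp: beyond_def)
  then obtain w where w: "y \<in> V" "E w y" "conn (V - {y}) t w" and ty: "conn V t y"
    using conn_exit False conn_exit_conn by blast
  have "conn (beyond V v y) t w"
    using w(3) by (rule conn_within) (use beyond_closed assms in blast)
  moreover have "y \<in> beyond V v y"
    using ty \<open>conn V t v\<close> by (blast intro: beyond_self conn_sym conn_trans)
  ultimately show ?thesis using w(2) by (blast intro: conn_step)
qed

lemma beyond_subset_comp: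
  assumes "y \<noteq> v"
  shows "beyond V v y \<subseteq> comp_of (V - {v}) y"
proof
  fix t assume t: "t \<in> beyond V v y"
  have "conn (V - {v}) t y"
    by (rule conn_avoid) (use t assms in \<open>auto simp: beyond_def\<close>)
  then show "t \<in> comp_of (V - {v}) y" using conn_sym by (simp add: comp_of_def)
qed

text \<open>A walk from \<open>t\<close> to \<open>v\<close> avoiding \<open>s\<close> would pass
  through \<open>y\<close>, and then \<open>y\<close> would reach \<open>v\<close> without
  \<open>s\<close>. Strictness comes from \<open>s\<close> itself, which reaches \<open>v\<close>
  without \<open>y\<close>.\<close>

lemma beyond_psubset:
  assumes "y \<in> beyond V v s" "y \<noteq> s" "s \<noteq> v"
  shows "beyond V v y \<subset> beyond V v s"
proof
  show "beyond V v y \<subseteq> beyond V v s"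
  proof
    fix t assume t: "t \<in> beyond V v y"
    have "\<not> conn (V - {s}) t v"
    proof
      assume c: "conn (V - {s}) t v"
      have "\<not> conn (V - {s} - {y}) t v"
        using t conn_mono[of "V - {s} - {y}" t v "V - {y}"] by (auto simp: beyond_def)
      with c have "conn (V - {s}) t y" by (rule conn_exit_conn)
      then have "conn (V - {s}) y v" using c conn_sym conn_trans by blast
      then show False using assms(1) by (simp add: beyond_def)
    qed
    then show "t \<in> beyond V v s" using t by (simp add: beyond_def)
  qed
  have y: "conn V y v" "\<not> conn (V - {s}) y v" using assms by (auto simp: beyond_def)
  have "conn (V - {y}) v s"
    by (rule conn_avoid) (use y conn_sym assms in blast)+
  then have "s \<notin> beyond V v y" using conn_sym by (auto simp: beyond_def)
  moreover have "s \<in> beyond V v s"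
    using conn_exit_conn[OF y] y(1) by (blast intro: beyond_self conn_sym conn_trans)
  ultimately show "beyond V v y \<noteq> beyond V v s" by blast
qed

text \<open>
  Exchanging \<open>y\<close> for \<open>u\<close>: the new component of \<open>u\<close> is covered by \<open>beyond V v c\<close> and what is left of the
  component of \<open>y\<close> after removing \<open>beyond V v y\<close>. Indeed anything leaving \<open>beyond V v c\<close> does so next
  to \<open>c\<close>, in the clique through which \<open>c\<close> is joined to \<open>y\<close> inside \<open>A\<close>.
\<close>

lemma component_exchange:
  assumes V: "finite V" "separable V" and A: "A \<subseteq> V" "y \<in> A" and DA: "D \<subseteq> A"
    and beyond_A: "beyond V v y \<subseteq> A"
    and conns: "conn V y v" "conn V c v"
    and u: "u \<in> V" "u \<notin> A" "u \<in> beyond V v c"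
    and y: "y \<notin> beyond V v c" and yc: "conn (insert y (insert c D)) y c"
    and le: "card (beyond V v c) \<le> card (beyond V v y)"
  shows "card (comp_of (insert u (A - {y})) u) \<le> card (comp_of A y)"
proof -
  let ?M = "comp_of (insert u (A - {y})) u" and ?T = "beyond V v"
  have finT: "finite (?T z)" for z
    using V(1) by (rule finite_subset[rotated]) (auto simp: beyond_def dest: conn_in)
  \<comment> \<open>The vertices of \<open>?T y\<close> count in the component of \<open>y\<close>
    but will not occur in the new component of \<open>u\<close>; this pays for those of
    \<open>?T c\<close>.\<close>
  have TN: "?T y \<subseteq> comp_of A y"
  proof
    fix t assume "t \<in> ?T y"
    then have "conn A t y" using conn_mono[OF beyond_connected beyond_A] by blast
    then show "t \<in> comp_of A y" using conn_sym by (simp add: comp_of_def)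
  qed
  have XV: "insert u (A - {y}) \<subseteq> V - {y}" using A u by blast
  have "y \<noteq> c" using y beyond_self conns by blast
  have Ty_u: "u \<notin> ?T y" using beyond_A u by blast
  have conn_v: "conn (V - {c}) t v" if "conn V t v" "t \<notin> ?T c" for t
    using that by (simp add: beyond_def)
  have "?M \<subseteq> ?T c \<union> (comp_of A y - ?T y)"
  proof
    fix z assume "z \<in> ?M"
    then have zu: "conn (insert u (A - {y})) z u"
      using conn_sym by (simp add: comp_of_def)
    then have zu': "conn (V - {y}) z u" using XV by (rule conn_mono)
    have zV: "conn V z u" using zu' by (rule conn_mono) blast
    have uv: "conn V u v" using u by (simp add: beyond_def)
    have zv: "conn V z v" using zV uv by (rule conn_trans)
    have zT: "z \<notin> ?T y" using beyond_closed[OF _ zu'] Ty_u by blast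
    have "z \<in> comp_of A y" if zc: "z \<notin> ?T c"
    proof -
      have sep: "\<not> conn (V - {c}) z t" if "t \<in> ?T c" for t
        using beyond_closed[OF that] zc conn_sym by blast
      have "z \<noteq> c" using zc beyond_self conns by blast
      have "\<not> conn (insert u (A - {y}) - {c}) z u"
        using sep[OF u(3)] conn_mono[of "insert u (A - {y}) - {c}" z u "V - {c}"] XV by blast
      then obtain w where w: "E w c" "conn (insert u (A - {y}) - {c}) z w"
        using conn_exit[OF zu] \<open>z \<noteq> c\<close> by blast
      have zw: "conn (V - {c}) z w"
        using w(2) by (rule conn_mono) (use XV in blast)
      have zwA: "conn A z w"
        using w(2)
      proof (rule conn_within)
        fix t assume t: "conn (insert u (A - {y}) - {c}) z t"
        then have "conn (V - {c}) z t" by (rule conn_mono) (use XV in blast)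
        then have "t \<noteq> u" using sep u(3) by blast
        then show "t \<in> A" using conn_in[OF t] by blast
      qed
      \<comment> \<open>The vertex \<open>d\<close> before \<open>c\<close> on the connection from
        \<open>y\<close> is \<open>y\<close> or lies in \<open>D\<close>, hence in \<open>A\<close>,
        whereas \<open>c\<close> may lie outside \<open>A\<close>.\<close>
      have "\<not> conn (insert y (insert c D) - {c}) y c" using conn_in by blast
      then obtain d where d: "E d c" "conn (insert y (insert c D) - {c}) y d"
        using conn_exit[OF yc] \<open>y \<noteq> c\<close> by blast
      have ydA: "conn A y d"
        using d(2) by (rule conn_mono) (use DA A in blast)
      have "conn (V - {c}) y d"
        using d(2) by (rule conn_mono) (use DA A in blast)
      moreover have "conn (V - {c}) z y"
        using conn_v[OF zv zc] conn_v[OF conns(1) y] conn_sym conn_trans by blast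
      ultimately have "conn (V - {c}) w d"
        using zw conn_sym conn_trans by blast
      \<comment> \<open>Both are neighbours of \<open>c\<close> and joined without \<open>c\<close>,
        so they lie in one clique and \<open>c\<close> can be bypassed inside
        \<open>A\<close>.\<close>
      then have "w = d \<or> E w d"
        using separable_adj[OF V(2) _ w(1) d(1)] conn_in[OF conns(2)] by blast
      then have "conn A w d"
        using conn_in[OF zwA] conn_in[OF ydA] by (auto intro: conn_refl conn_adj)
      then have "conn A z y" using zwA ydA conn_sym conn_trans by blast
      then show ?thesis using conn_sym by (simp add: comp_of_def)
    qed
    then show "z \<in> ?T c \<union> (comp_of A y - ?T y)" using zT by blast
  qed
  moreover have finN: "finite (comp_of A y)"
    using A V(1) finite_comp_of finite_subset by blast
  ultimately have "card ?M \<le> card (?T c \<union> (comp_of A y - ?T y))"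
    using finT by (intro card_mono) auto
  also have "\<dots> \<le> card (?T c) + card (comp_of A y - ?T y)" by (rule card_Un_le)
  also have "\<dots> = card (?T c) + (card (comp_of A y) - card (?T y))"
    using TN finT by (simp add: card_Diff_subset)
  also have "\<dots> \<le> card (comp_of A y)"
    using le card_mono[OF finN TN] by linarith
  finally show ?thesis .
qed

section \<open>Existence of a shedding vertex\<close>

definition shedding :: "nat \<Rightarrow> 'a set \<Rightarrow> 'a set \<Rightarrow> 'a \<Rightarrow> bool" where
  "shedding r V D v \<longleftrightarrow>
     (\<forall>A. D \<subseteq> A \<longrightarrow> A \<subseteq> V \<longrightarrow> v \<in> A \<longrightarrow> bounded_comps r A \<longrightarrow>
        (\<exists>u\<in>V - A. bounded_comps r (insert u (A - {v}))))"

lemma sheddingI: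
  assumes "finite V"
    and "\<And>A. D \<subseteq> A \<Longrightarrow> A \<subseteq> V \<Longrightarrow> v \<in> A \<Longrightarrow> bounded_comps r A \<Longrightarrow>
      \<exists>u\<in>V - A. card (comp_of (insert u (A - {v})) u) \<le> r"
  shows "shedding r V D v"
  unfolding shedding_def
proof (intro allI impI)
  fix A assume A: "D \<subseteq> A" "A \<subseteq> V" "v \<in> A" "bounded_comps r A"
  then obtain u where "u \<in> V - A" "card (comp_of (insert u (A - {v})) u) \<le> r"
    using assms(2) by blast
  moreover from this have "bounded_comps r (insert u (A - {v}))"
    using bounded_comps_insert[OF A(4)] A(2) assms(1) finite_subset
    by (metis Diff_subset insert_mono)
  ultimately show "\<exists>u\<in>V - A. bounded_comps r (insert u (A - {v}))" by blast
qed

text \<open>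
  Unless every vertex outside \<open>D\<close> breaks the large components, take a large component \<open>K\<close> cut off by
  deleting some \<open>v\<close> outside \<open>D\<close>, with \<open>K\<close> as small as possible. The vertex \<open>y\<close> of \<open>K - D\<close> that separates
  the most from \<open>v\<close> is shedding.
\<close>

lemma exists_shedding:
  assumes V: "finite V" "separable V" and D: "D \<subseteq> V" "bounded_comps r D" and big: "\<not> bounded_comps r V"
  shows "\<exists>v\<in>V - D. shedding r V D v"
proof -
  \<comment> \<open>\<open>k\<close> names a component of \<open>V - {v}\<close>;
    \<open>conn V k v\<close> keeps it within the component of \<open>V\<close> that contains
    \<open>v\<close>, so components untouched by the deletion do not count.\<close>
  define heavy where "heavy = (\<lambda>(v, k). v \<in> V - D \<and> conn V k v \<and> k \<in> V - {v} \<and> r < card (comp_of (V - {v}) k))"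
  have free: "\<not> C \<subseteq> D" if "\<And>x y. x \<in> C \<Longrightarrow> y \<in> C \<Longrightarrow> conn C x y" "r < card C" "C \<subseteq> V" for C
  proof
    assume "C \<subseteq> D"
    have "C \<noteq> {}" using that(2) by auto
    then obtain x where x: "x \<in> C" by blast
    then have "C \<subseteq> comp_of D x"
      using conn_mono[OF that(1) \<open>C \<subseteq> D\<close>] by (auto simp: comp_of_def)
    then have "card C \<le> card (comp_of D x)"
      by (rule card_mono[OF finite_comp_of[OF finite_subset[OF D(1) V(1)]]])
    also have "\<dots> \<le> r" using D(2) x \<open>C \<subseteq> D\<close> by (auto simp: bounded_comps_def)
    finally show False using that(2) by simp
  qed
  have not_within: "\<not> C \<subseteq> A" if "\<And>x y. x \<in> C \<Longrightarrow> y \<in> C \<Longrightarrow> conn C x y" "r < card C"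
    "bounded_comps r A" "A \<subseteq> V" for C A
  proof
    assume "C \<subseteq> A"
    have "C \<noteq> {}" using that(2) by auto
    then obtain x where x: "x \<in> C" by blast
    then have "C \<subseteq> comp_of A x"
      using conn_mono[OF that(1) \<open>C \<subseteq> A\<close>] by (auto simp: comp_of_def)
    then have "card C \<le> card (comp_of A x)"
      by (rule card_mono[OF finite_comp_of[OF finite_subset[OF that(4) V(1)]]])
    also have "\<dots> \<le> r" using that(3) x \<open>C \<subseteq> A\<close> by (auto simp: bounded_comps_def)
    finally show False using that(2) by simp
  qed
  have comp_conn: "conn (comp_of X a) x y" if "x \<in> comp_of X a" "y \<in> comp_of X a" for X a x y
  proof -
    have "conn (comp_of X a) a x" "conn (comp_of X a) a y"
      using that conn_comp_of by (auto simp: comp_of_def)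
    then show ?thesis by (rule conn_common)
  qed
  show ?thesis
  proof (cases "\<exists>p. heavy p")
    case False
    obtain a where a: "a \<in> V" "r < card (comp_of V a)"
      using big by (auto simp: bounded_comps_def not_le)
    \<comment> \<open>With no heavy pair, deleting \<open>v\<close> breaks its component into pieces
      of size at most \<open>r\<close>, so any \<open>u\<close> of that component missing from the
      face can replace \<open>v\<close>.\<close>
    obtain v where v: "v \<in> comp_of V a" "v \<notin> D"
      using free[OF comp_conn a(2) comp_of_subset] by blast
    have vV: "v \<in> V" and av: "conn V a v" using v conn_in by (auto simp: comp_of_def)
    have "shedding r V D v"
    proof (rule sheddingI[OF V(1)])
      fix A assume A: "D \<subseteq> A" "A \<subseteq> V" "v \<in> A" "bounded_comps r A"
      obtain u where u: "u \<in> comp_of V a" "u \<notin> A"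
        using not_within[OF comp_conn a(2) A(4,2)] by blast
      have au: "conn V a u" using u by (simp add: comp_of_def)
      then have uV: "u \<in> V" and uv: "conn V u v"
        using conn_in[OF au] conn_common[OF au av] by auto
      have "\<not> heavy (v, u)" using False by blast
      then have "card (comp_of (V - {v}) u) \<le> r"
        using vV v uV uv u(2) A(3) by (auto simp: heavy_def)
      then have "card (comp_of (insert u (A - {v})) u) \<le> r"
        by (rule card_comp_of_mono) (use uV u A V(1) in auto)
      then show "\<exists>u\<in>V - A. card (comp_of (insert u (A - {v})) u) \<le> r"
        using uV u by blast
    qed
    then show ?thesis using vV v by blast
  next
    case True
    define size where "size = (\<lambda>(v, k). card (comp_of (V - {v}) k))"
    obtain p where "heavy p" and p_min: "\<And>q. heavy q \<Longrightarrow> size p \<le> size q"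
      using True ex_has_least_nat[of heavy _ size] by blast
    obtain v k where vk: "p = (v, k)" by (cases p)
    have "heavy (v, k)" and vk_min: "\<And>q. heavy q \<Longrightarrow> size (v, k) \<le> size q"
      using \<open>heavy p\<close> p_min vk by auto
    define K where "K = comp_of (V - {v}) k"
    have vV: "v \<in> V" "v \<notin> D" and k: "conn V k v" "k \<in> V" "k \<noteq> v" and Kr: "r < card K"
      using \<open>heavy (v, k)\<close> by (auto simp: heavy_def K_def)
    have finK: "finite K" using V(1) by (simp add: K_def finite_comp_of)
    have KV: "K \<subseteq> V - {v}" unfolding K_def by (rule comp_of_subset)
    have K_conn: "conn K x y" if "x \<in> K" "y \<in> K" for x y
      using comp_conn that unfolding K_def by blast
    have K_closed: "z \<in> K" if "x \<in> K" "conn (V - {v}) x z" for x z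
      using that conn_trans[of "V - {v}" k x z] by (simp add: K_def comp_of_def)
    have Kv: "conn V x v" if "x \<in> K" for x
    proof -
      have "conn (V - {v}) k x" using that by (simp add: K_def comp_of_def)
      then have "conn V k x" by (rule conn_mono) blast
      then show ?thesis using k(1) conn_common by blast
    qed
    let ?T = "beyond V v"
    have TK: "?T y \<subseteq> K" if "y \<in> K" for y
      using beyond_subset_comp[of y v V] K_closed that KV by (auto simp: comp_of_def)
    \<comment> \<open>A piece cut off by \<open>y\<close> lies in \<open>K\<close> and misses
      \<open>y\<close>; if it were large, it would give a heavy pair with a smaller component than
      \<open>K\<close>.\<close>
    have light: "card (comp_of (V - {y}) t) \<le> r" if y: "y \<in> K - D" and t: "t \<in> ?T y" "t \<noteq> y" for y t
    proof (rule ccontr)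
      assume "\<not> ?thesis"
      then have "heavy (y, t)"
        using t y KV subsetD[OF TK t(1)] conn_mono[OF beyond_connected[OF t(1)] subset_trans[OF TK]]
        by (auto simp: heavy_def)
      then have "card K \<le> card (comp_of (V - {y}) t)"
        using vk_min by (force simp: size_def K_def)
      moreover have "comp_of (V - {y}) t \<subseteq> ?T y - {y}"
        using beyond_closed[OF t(1)] conn_in[of "V - {y}" t] by (auto simp: comp_of_def)
      then have "comp_of (V - {y}) t \<subseteq> K - {y}" using TK y by blast
      then have "comp_of (V - {y}) t \<subset> K" using y by blast
      then have "card (comp_of (V - {y}) t) < card K" by (rule psubset_card_mono[OF finK])
      ultimately show False by simp
    qed
    have swap_beyond: "\<exists>u\<in>V - A. card (comp_of (insert u (A - {y})) u) \<le> r"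
      if y: "y \<in> K - D" and A: "A \<subseteq> V" "y \<in> A" "\<not> ?T y \<subseteq> A" for y A
    proof -
      obtain u where u: "u \<in> ?T y" "u \<notin> A" using A(3) by blast
      then have uV: "u \<in> V" using TK y KV by blast
      have "u \<noteq> y" using u A by blast
      then have "card (comp_of (V - {y}) u) \<le> r" using light[OF y u(1)] by blast
      then have "card (comp_of (insert u (A - {y})) u) \<le> r"
        by (rule card_comp_of_mono) (use uV u A V(1) in auto)
      then show ?thesis using uV u by blast
    qed
    have finT: "finite (?T x)" if "x \<in> K" for x
      using TK[OF that] finK by (rule finite_subset)
    have cardT: "card (?T x) < Suc (card K)" if "x \<in> K" for x
      using card_mono[OF finK TK[OF that]] by simp
    have "\<exists>x. x \<in> K - D" using free[OF K_conn Kr] KV by blast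
    then obtain y where y: "y \<in> K - D" and y_max: "\<And>x. x \<in> K - D \<Longrightarrow> card (?T x) \<le> card (?T y)"
      using ex_has_greatest_nat[of "\<lambda>x. x \<in> K - D" _ "\<lambda>x. card (?T x)" "Suc (card K)"] cardT
      by blast
    have "shedding r V D y"
    proof (rule sheddingI[OF V(1)])
      fix A assume A: "D \<subseteq> A" "A \<subseteq> V" "y \<in> A" "bounded_comps r A"
      show "\<exists>u\<in>V - A. card (comp_of (insert u (A - {y})) u) \<le> r"
      proof (cases "?T y \<subseteq> A")
        case False
        then show ?thesis using swap_beyond y A by blast
      next
        case TyA: True
        obtain u where u: "u \<in> K" "u \<notin> A" using not_within[OF K_conn Kr A(4,2)] by blast
        \<comment> \<open>The vertices of \<open>K - D\<close> that cut \<open>u\<close> off from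
          \<open>v\<close>, with \<open>u\<close> itself among them; the \<open>c\<close> chosen
          from them has the most beyond it.\<close>
        define S where "S = {c\<in>K - D. u \<in> ?T c}"
        have "u \<in> S" using u A(1) Kv beyond_self by (auto simp: S_def)
        then obtain c where c: "c \<in> S" and c_max: "\<And>x. x \<in> S \<Longrightarrow> card (?T x) \<le> card (?T c)"
          using ex_has_greatest_nat[of "\<lambda>x. x \<in> S" u "\<lambda>x. card (?T x)" "Suc (card K)"] cardT
          unfolding S_def by blast
        have cK: "c \<in> K" "c \<notin> D" "u \<in> ?T c" using c by (auto simp: S_def)
        have "c \<noteq> y" using TyA cK u by blast
        \<comment> \<open>Otherwise \<open>c\<close>, also in \<open>K - D\<close>, would have more
          beyond it than \<open>y\<close>.\<close>
        have yTc: "y \<notin> ?T c"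
        proof
          assume "y \<in> ?T c"
          then have "?T y \<subset> ?T c" using beyond_psubset \<open>c \<noteq> y\<close> cK KV by blast
          then have "card (?T y) < card (?T c)" using finT cK by (intro psubset_card_mono) auto
          then show False using y_max[of c] cK by simp
        qed
        have "conn V y c"
          by (rule conn_mono[OF K_conn]) (use y cK KV in blast)+
        then have "conn (insert y (insert c D)) y c"
        proof (rule conn_by_separators[OF V])
          fix s assume s: "s \<noteq> y" "s \<noteq> c" "\<not> conn (V - {s}) y c"
          have "s \<in> K"
          proof (rule ccontr)
            assume "s \<notin> K"
            have "conn (V - {s}) y c"
              by (rule conn_mono[OF K_conn]) (use \<open>s \<notin> K\<close> y cK KV in blast)+
            then show False using s by blast
          qed
          show "s \<in> D"
          proof (rule ccontr)
            assume "s \<notin> D"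
            \<comment> \<open>A separator of \<open>y\<close> and \<open>c\<close> separates one of
              them from \<open>v\<close>, or is joined to neither; outside \<open>D\<close> it would
              beat \<open>y\<close> in \<open>K - D\<close> or \<open>c\<close> in
              \<open>S\<close>.\<close>
            have "\<not> (conn (V - {s}) y v \<and> conn (V - {s}) c v)"
              using s(3) conn_common conn_sym by blast
            then consider "y \<in> ?T s" | "c \<in> ?T s"
              using Kv y cK by (auto simp: beyond_def)
            then show False
            proof cases
              case 1
              then have "?T y \<subset> ?T s" using beyond_psubset s \<open>s \<in> K\<close> KV by blast
              then have "card (?T y) < card (?T s)" using finT \<open>s \<in> K\<close> by (intro psubset_card_mono) auto
              then show False using y_max[of s] \<open>s \<in> K\<close> \<open>s \<notin> D\<close> by simp
            next
              case 2
              then have *: "?T c \<subset> ?T s" using beyond_psubset s \<open>s \<in> K\<close> KV by blast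
              then have "card (?T c) < card (?T s)" using finT \<open>s \<in> K\<close> by (intro psubset_card_mono) auto
              moreover have "s \<in> S" using * cK \<open>s \<in> K\<close> \<open>s \<notin> D\<close> by (auto simp: S_def)
              ultimately show False using c_max[of s] by simp
            qed
          qed
        qed
        moreover have "card (?T c) \<le> card (?T y)" using y_max cK by blast
        ultimately have "card (comp_of (insert u (A - {y})) u) \<le> card (comp_of A y)"
          using component_exchange[OF V A(2,3,1) TyA Kv Kv _ u(2) cK(3) yTc] y cK u KV by blast
        also have "\<dots> \<le> r" using A by (auto simp: bounded_comps_def)
        finally show ?thesis using u KV by blast
      qed
    qed
    then show ?thesis using y KV by blast
  qed
qed

section \<open>Recursive shelling of the facets\<close>

text \<open>
  The facets containing \<open>D\<close> of the complex on \<open>V\<close>. They are kept as subsets of \<open>V\<close>, instead of passing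
  to the link of \<open>D\<close>, so that \<open>bounded_comps\<close> still refers to the same graph.
\<close>

definition facets_over :: "nat \<Rightarrow> 'a set \<Rightarrow> 'a set \<Rightarrow> 'a set set" where
  "facets_over r V D =
     {A. D \<subseteq> A \<and> A \<subseteq> V \<and> bounded_comps r A \<and> (\<forall>u\<in>V - A. \<not> bounded_comps r (insert u A))}"

lemma facets_over_extend:
  assumes "finite V" "D \<subseteq> B" "B \<subseteq> V" "bounded_comps r B"
  shows "\<exists>F\<in>facets_over r V D. B \<subseteq> F"
proof -
  let ?P = "\<lambda>A. B \<subseteq> A \<and> A \<subseteq> V \<and> bounded_comps r A"
  have "\<forall>A. ?P A \<longrightarrow> card A < Suc (card V)"
    using assms(1) by (auto simp: less_Suc_eq_le intro: card_mono)
  then obtain F where F: "?P F" and max: "\<And>A. ?P A \<Longrightarrow> card A \<le> card F"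
    using ex_has_greatest_nat[of ?P B card "Suc (card V)"] assms by blast
  have "\<not> bounded_comps r (insert u F)" if "u \<in> V - F" for u
  proof
    assume "bounded_comps r (insert u F)"
    then have "card (insert u F) \<le> card F" using F that by (intro max) auto
    moreover have "finite F" using F assms(1) finite_subset by blast
    ultimately show False using that by simp
  qed
  then show ?thesis using F assms(2) by (auto simp: facets_over_def)
qed

text \<open>If a facet of the deletion could be enlarged by \<open>v\<close>, shedding would
  exchange \<open>v\<close> for some \<open>u\<close>, and this \<open>u\<close> would enlarge the
  facet inside \<open>V - {v}\<close>.\<close>

lemma facets_over_shedding:
  assumes "finite V" and v: "v \<in> V - D" "shedding r V D v"
  shows "facets_over r V D = facets_over r (V - {v}) D \<union> facets_over r V (insert v D)"
proof (intro equalityI subsetI)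
  fix A assume "A \<in> facets_over r V D"
  then show "A \<in> facets_over r (V - {v}) D \<union> facets_over r V (insert v D)"
    by (cases "v \<in> A") (auto simp: facets_over_def)
next
  fix A assume A: "A \<in> facets_over r (V - {v}) D \<union> facets_over r V (insert v D)"
  show "A \<in> facets_over r V D"
  proof (cases "A \<in> facets_over r V (insert v D)")
    case True
    then show ?thesis by (auto simp: facets_over_def)
  next
    case False
    then have A': "A \<in> facets_over r (V - {v}) D" using A by blast
    then have AV: "D \<subseteq> A" "A \<subseteq> V - {v}" by (auto simp: facets_over_def)
    have "\<not> bounded_comps r (insert v A)"
    proof
      assume "bounded_comps r (insert v A)"
      then obtain u where u: "u \<in> V - insert v A" "bounded_comps r (insert u (insert v A - {v}))"
        using v(2) AV v(1) unfolding shedding_def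
        by (metis DiffD1 Diff_subset insert_subset insertI1 subset_insertI2 subset_trans)
      moreover have "insert v A - {v} = A" using AV by blast
      ultimately show False using A' by (auto simp: facets_over_def)
    qed
    then show ?thesis using A' by (auto simp: facets_over_def)
  qed
qed

text \<open>Induction on the number of undecided vertices \<open>V - D\<close>, which drops both
  when the shedding vertex is deleted and when it is put into \<open>D\<close>.\<close>

theorem shelling_facets_over:
  assumes "finite V" "separable V" "D \<subseteq> V"
  shows "\<exists>Fs. shelling Fs \<and> set Fs = facets_over r V D"
  using assms
proof (induction "card (V - D)" arbitrary: V D rule: less_induct)
  case less
  consider "bounded_comps r V" | "\<not> bounded_comps r D" | "bounded_comps r D" "\<not> bounded_comps r V"
    by blast
  then show ?case
  proof cases
    case 1
    then have "facets_over r V D = {V}"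
      using less.prems bounded_comps_subset[OF 1] by (auto simp: facets_over_def)
    then show ?thesis by (intro exI[of _ "[V]"]) (auto simp: shelling_def)
  next
    case 2
    have "A \<notin> facets_over r V D" for A
    proof
      assume A: "A \<in> facets_over r V D"
      then have "finite A" using less.prems(1) finite_subset by (auto simp: facets_over_def)
      then show False using A 2 bounded_comps_subset by (auto simp: facets_over_def)
    qed
    then have "facets_over r V D = {}" by blast
    then show ?thesis by (intro exI[of _ "[]"]) (auto simp: shelling_def)
  next
    case 3
    obtain v where v: "v \<in> V - D" "shedding r V D v"
      using exists_shedding[OF less.prems 3] by blast
    have fin: "finite (V - D)" using less.prems(1) by simp
    have "V - {v} - D \<subset> V - D" "V - insert v D \<subset> V - D" using v(1) by blast+
    then have "card (V - {v} - D) < card (V - D)" "card (V - insert v D) < card (V - D)"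
      using psubset_card_mono[OF fin] by blast+
    moreover have "separable (V - {v})" using less.prems(2) by (rule separable_subset) blast
    ultimately obtain xs ys where
      xs: "shelling xs" "set xs = facets_over r (V - {v}) D" and
      ys: "shelling ys" "set ys = facets_over r V (insert v D)"
      using less.hyps[of "V - {v}" D] less.hyps[of V "insert v D"] less.prems v(1)
      by (metis DiffE finite_Diff insert_subset subset_Diff_insert Diff_empty)
    have "shelling (xs @ ys)"
    proof (rule shelling_append[OF xs(1) ys(1)])
      show "set xs \<inter> set ys = {}" unfolding xs(2) ys(2) by (auto simp: facets_over_def)
      fix x y assume x: "x \<in> set xs" and y: "y \<in> set ys"
      have xD: "v \<notin> x" using x unfolding xs(2) by (auto simp: facets_over_def)
      have yD: "insert v D \<subseteq> y" "y \<subseteq> V" "bounded_comps r y"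
        using y unfolding ys(2) by (auto simp: facets_over_def)
      \<comment> \<open>The exchange yields a face that avoids \<open>v\<close> and contains
        \<open>y - {v}\<close>; a facet of the first list above it serves as \<open>x'\<close>, with
        \<open>v\<close> as \<open>w\<close>.\<close>
      then obtain u where u: "u \<in> V - y" "bounded_comps r (insert u (y - {v}))"
        using v(2) unfolding shedding_def by (meson insert_subset)
      have "D \<subseteq> insert u (y - {v})" "insert u (y - {v}) \<subseteq> V - {v}"
        using yD u(1) v(1) by auto
      then obtain F where "F \<in> facets_over r (V - {v}) D" "insert u (y - {v}) \<subseteq> F"
        using facets_over_extend[of "V - {v}"] u(2) less.prems(1) by blast
      then show "\<exists>w\<in>y - x. \<exists>x'\<in>set xs. y - {w} \<subseteq> x'"
        unfolding xs(2) using xD yD by (intro bexI[of _ v] bexI[of _ F]) auto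
    qed
    moreover have "set (xs @ ys) = facets_over r V D"
      using facets_over_shedding[OF less.prems(1) v] xs ys by simp
    ultimately show ?thesis by blast
  qed
qed

end

section \<open>Block graphs\<close>

context graph
begin

interpretation adj: adjacency "\<lambda>x y. x \<rightarrow>\<^bsub>G\<^esub> y"
  by unfold_locales (rule graph_symmetric)

lemma adj_induce_iff: "x \<rightarrow>\<^bsub>G \<restriction> S\<^esub> y \<longleftrightarrow> x \<rightarrow>\<^bsub>G\<^esub> y \<and> x \<in> S \<and> y \<in> S"
  by (auto simp: arcs_ends_conv)

lemma reachable_induce_iff: "x \<rightarrow>\<^sup>*\<^bsub>G \<restriction> S\<^esub> y \<longleftrightarrow> adj.conn S x y"
proof
  interpret S: wf_digraph "G \<restriction> S" by (rule wellformed_induce_subgraph)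
  show "adj.conn S x y" if "x \<rightarrow>\<^sup>*\<^bsub>G \<restriction> S\<^esub> y"
    using that
  proof (induction rule: S.reachable_induct)
    case base
    then show ?case by (simp add: adj.conn_refl)
  next
    case (step y z)
    then show ?case by (auto simp: adj_induce_iff intro: adj.conn_step)
  qed
  show "x \<rightarrow>\<^sup>*\<^bsub>G \<restriction> S\<^esub> y" if "adj.conn S x y"
    using that
  proof (induction rule: adj.conn.induct)
    case (conn_refl a)
    then show ?case by simp
  next
    case (conn_step a b c)
    then have "b \<rightarrow>\<^bsub>G \<restriction> S\<^esub> c" by (simp add: adj_induce_iff adj.conn_in)
    with conn_step.IH show ?case by (rule S.reachable_adj_trans)
  qed
qed

lemma symmetric_induce: "symmetric (G \<restriction> S)"
  unfolding symmetric_def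
proof (rule symI)
  fix x y assume "x \<rightarrow>\<^bsub>G \<restriction> S\<^esub> y"
  then show "y \<rightarrow>\<^bsub>G \<restriction> S\<^esub> x"
    unfolding adj_induce_iff using graph_symmetric by blast
qed

lemma sym_digraph_induce: "sym_digraph (G \<restriction> S)"
  by (rule wf_digraph.sym_digraphI[OF wellformed_induce_subgraph symmetric_induce])

text \<open>\<open>connected\<close> refers to the symmetric closure, which adds no reachability to
  a symmetric digraph.\<close>

lemma connected_induce_iff:
  "connected (G \<restriction> S) \<longleftrightarrow> S \<noteq> {} \<and> (\<forall>x\<in>S. \<forall>y\<in>S. adj.conn S x y)"
proof -
  have "x \<rightarrow>\<^sup>*\<^bsub>mk_symmetric (G \<restriction> S)\<^esub> y \<longleftrightarrow> adj.conn S x y" for x y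
    unfolding wf_digraph.reachable_mk_symmetric_eq[OF wellformed_induce_subgraph symmetric_induce]
    by (rule reachable_induce_iff)
  then show ?thesis by (simp add: connected_def strongly_connected_def)
qed

lemma sccs_induce: "verts ` pre_digraph.sccs (G \<restriction> A) = adj.comp_of A ` A"
proof -
  interpret A: sym_digraph "G \<restriction> A" by (rule sym_digraph_induce)
  have "A.scc_of a = adj.comp_of A a" for a
    unfolding A.scc_of_def adj.comp_of_def reachable_induce_iff using adj.conn_sym by blast
  then show ?thesis
    using A.sccs_verts_conv A.sccs_verts_conv_scc_of by simp
qed

lemma r_independent_iff:
  "r_independent r G A \<longleftrightarrow> A \<subseteq> verts G \<and> adj.bounded_comps r A"
proof -
  have "(\<forall>C\<in>pre_digraph.sccs (G \<restriction> A). card (verts C) \<le> r) \<longleftrightarrow>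
      (\<forall>K\<in>verts ` pre_digraph.sccs (G \<restriction> A). card K \<le> r)"
    by blast
  then show ?thesis by (simp add: r_independent_def adj.bounded_comps_def sccs_induce)
qed

text \<open>\<open>facets\<close> compares with all larger faces, \<open>facets_over\<close> with
  those having one more vertex; closure of the faces under subsets makes the two agree.\<close>

lemma facets_Ind: "facets (Ind r G) = adj.facets_over r (verts G) {}"
proof (intro equalityI subsetI)
  fix A assume A: "A \<in> facets (Ind r G)"
  have "\<not> adj.bounded_comps r (insert u A)" if "u \<in> verts G - A" for u
    using A that unfolding facets_def Ind_def r_independent_iff by blast
  then show "A \<in> adj.facets_over r (verts G) {}"
    using A unfolding adj.facets_over_def facets_def Ind_def r_independent_iff by blast
next
  fix A assume A: "A \<in> adj.facets_over r (verts G) {}"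
  have "B = A" if B: "A \<subseteq> B" "B \<subseteq> verts G" "adj.bounded_comps r B" for B
  proof (rule ccontr)
    assume "B \<noteq> A"
    then obtain u where "u \<in> B - A" using B by blast
    moreover from this have "adj.bounded_comps r (insert u A)"
      using adj.bounded_comps_subset[OF B(3) _ finite_subset[OF B(2) finite_verts]] B(1) by simp
    ultimately show False using A B by (auto simp: adj.facets_over_def)
  qed
  then show "A \<in> facets (Ind r G)"
    using A unfolding adj.facets_over_def facets_def Ind_def r_independent_iff by blast
qed

section \<open>Blocks and inseparable pairs\<close>

text \<open>The number of vertices plus arcs is maximised. A supergraph of no greater size has the
  same vertices and arcs, and by compatibility the same end maps, so it is the same record.\<close>

lemma max_subgraph_exists:
  assumes "subgraph B G" "P B"
  shows "\<exists>B'. max_subgraph P B' \<and> subgraph B B'"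
proof -
  let ?P = "\<lambda>B'. subgraph B' G \<and> P B' \<and> subgraph B B'"
  let ?size = "\<lambda>B'. card (verts B') + card (arcs B')"
  have card_le: "card (verts H) \<le> card (verts G)" "card (arcs H) \<le> card (arcs G)"
    if "subgraph H G" for H
    using that by (auto intro!: card_mono)
  have "\<forall>B'. ?P B' \<longrightarrow> ?size B' < Suc (?size G)"
    using card_le by (simp add: add_mono less_Suc_eq_le)
  moreover have "?P B"
    using assms wf_digraph.subgraph_refl by (auto simp: subgraph_def)
  ultimately obtain M where M: "?P M" and M_max: "\<And>H. ?P H \<Longrightarrow> ?size H \<le> ?size M"
    using ex_has_greatest_nat[of ?P B ?size "Suc (?size G)"] by blast
  have "\<not> (subgraph H G \<and> P H)" if H: "H \<noteq> M" "subgraph M H" for H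
  proof
    assume HG: "subgraph H G \<and> P H"
    then have le: "?size H \<le> ?size M" using M subgraph_trans[OF _ H(2)] by (intro M_max) blast
    have fin: "finite (verts H)" "finite (arcs H)"
      using HG by (auto intro: finite_subset[OF _ finite_verts] finite_subset[OF _ finite_arcs])
    have sub: "verts M \<subseteq> verts H" "arcs M \<subseteq> arcs H" using H(2) by auto
    have "card (verts M) \<le> card (verts H)" "card (arcs M) \<le> card (arcs H)"
      using sub fin by (auto intro: card_mono)
    then have "verts M = verts H" "arcs M = arcs H"
      using le card_seteq[OF fin(1) sub(1)] card_seteq[OF fin(2) sub(2)] by simp_all
    moreover have "tail M = tail H" "head M = head H"
      using H(2) by (auto simp: subgraph_def compatible_def)
    ultimately show False using H(1) by simp
  qed
  then show ?thesis using M by (auto simp: max_subgraph_def)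
qed

text \<open>A smallest vertex set within \<open>C\<close> in which no third vertex separates
  \<open>u\<close> from \<open>w\<close> induces a connected graph without cut vertex, and this
  extends to a block.\<close>

lemma inseparable_in_block:
  assumes uw: "adj.conn C u w" "u \<noteq> w" and C: "C \<subseteq> verts G"
    and insep: "\<And>z. z \<noteq> u \<Longrightarrow> z \<noteq> w \<Longrightarrow> adj.conn (C - {z}) u w"
  shows "\<exists>B\<in>blocks (G \<restriction> C). u \<in> verts B \<and> w \<in> verts B"
proof -
  let ?Q = "\<lambda>S. S \<subseteq> C \<and> adj.conn S u w \<and> (\<forall>z. z \<noteq> u \<longrightarrow> z \<noteq> w \<longrightarrow> adj.conn (S - {z}) u w)"
  obtain S where S: "?Q S" and S_min: "\<And>T. ?Q T \<Longrightarrow> card S \<le> card T"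
    using ex_has_least_nat[of ?Q C card] assms by blast
  have finS: "finite S" using S C finite_subset finite_verts by metis
  have min: "\<exists>z. z \<noteq> u \<and> z \<noteq> w \<and> \<not> adj.conn (T - {z}) u w"
    if "T \<subset> S" "adj.conn T u w" for T
  proof (rule ccontr)
    assume "\<not> ?thesis"
    then have "?Q T" using S that by blast
    then have "card S \<le> card T" by (rule S_min)
    then show False using psubset_card_mono[OF finS that(1)] by simp
  qed
  have two_conn: "adj.conn (S - {z}) x y" if "x \<in> S - {z}" "y \<in> S - {z}" for x y z
    using adj.minimal_inseparable_connected[OF _ uw(2) _ min that] S by blast
  have S_conn: "adj.conn S x y" if xy: "x \<in> S" "y \<in> S" for x y
  proof (cases "\<exists>z. z \<noteq> x \<and> z \<noteq> y")
    case True
    then obtain z where "z \<noteq> x" "z \<noteq> y" by blast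
    then have "adj.conn (S - {z}) x y" using two_conn[of x z y] xy by simp
    then show ?thesis by (rule adj.conn_mono) blast
  next
    case False
    \<comment> \<open>Every element of the type is \<open>x\<close> or \<open>y\<close> here, so
      these two are \<open>u\<close> and \<open>w\<close> in some order.\<close>
    then have "u = x \<or> u = y" "w = x \<or> w = y" by metis+
    then show ?thesis using uw(2) S adj.conn_sym[of S u w] by auto
  qed
  have uwS: "u \<in> S" "w \<in> S" using S adj.conn_in by blast+
  let ?P = "\<lambda>B. connected B \<and> no_cutvertex B"
  have PS: "?P (G \<restriction> S)"
  proof
    show "connected (G \<restriction> S)" using S_conn uwS by (auto simp: connected_induce_iff)
    have "pre_digraph.del_vert (G \<restriction> S) v = G \<restriction> (S - {v})" for v
      by (auto simp: pre_digraph.del_vert_def induce_subgraph_def)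
    then show "no_cutvertex (G \<restriction> S)"
      using two_conn by (auto simp: no_cutvertex_def connected_induce_iff)
  qed
  have SC: "subgraph (G \<restriction> S) (G \<restriction> C)"
    using S by (intro subgraphI wellformed_induce_subgraph) (auto simp: compatible_def)
  have "graph (G \<restriction> C)"
  proof -
    have "digraph (G \<restriction> C)" using C by (intro digraph_subgraph subgraph_induce_subgraphI)
    then show ?thesis using symmetric_induce by (rule digraph.graphI)
  qed
  from graph.max_subgraph_exists[where P = ?P, OF this SC PS]
  obtain B where B: "pre_digraph.max_subgraph (G \<restriction> C) ?P B" "subgraph (G \<restriction> S) B"
    by blast
  then have "B \<in> blocks (G \<restriction> C)" by (simp add: blocks_def)
  moreover have "S \<subseteq> verts B" using B(2) by (auto simp: subgraph_def)
  ultimately show ?thesis using uwS by blast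
qed

text \<open>Vertices of one component that no third vertex separates share a block of it; the block
  is a clique, so they are adjacent.\<close>

lemma block_graphs_imp_separable:
  assumes "\<And>H. H \<in> sccs \<Longrightarrow> block_graph H"
  shows "adj.separable (verts G)"
  unfolding adj.separable_def
proof (intro allI impI)
  fix u w assume uw: "adj.conn (verts G) u w" "u \<noteq> w" "\<not> u \<rightarrow>\<^bsub>G\<^esub> w"
  let ?C = "adj.comp_of (verts G) u"
  have "G \<restriction> verts G = G"
    using wellformed by (auto simp: induce_subgraph_def intro!: pre_digraph.equality)
  then have "?C \<in> verts ` sccs"
    using sccs_induce[of "verts G"] adj.conn_in[OF uw(1)] by auto
  then have C: "G \<restriction> ?C \<in> sccs" "?C \<subseteq> verts G"
    using in_sccs_verts_conv sccs_verts_conv adj.comp_of_subset by blast+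
  show "\<exists>z. z \<noteq> u \<and> z \<noteq> w \<and> \<not> adj.conn (verts G - {z}) u w"
  proof (rule ccontr)
    assume "\<not> ?thesis"
    then have insep: "adj.conn (verts G - {z}) u w" if "z \<noteq> u" "z \<noteq> w" for z
      using that by blast
    have insepC: "adj.conn (?C - {z}) u w" if z: "z \<noteq> u" "z \<noteq> w" for z
      using insep[OF z]
    proof (rule adj.conn_within)
      fix t assume t: "adj.conn (verts G - {z}) u t"
      then have "adj.conn (verts G) u t" by (rule adj.conn_mono) blast
      then show "t \<in> ?C - {z}" using adj.conn_in[OF t] by (simp add: adj.comp_of_def)
    qed
    obtain B where B: "B \<in> blocks (G \<restriction> ?C)" "u \<in> verts B" "w \<in> verts B"
      using inseparable_in_block[OF adj.conn_comp_of[OF uw(1)] uw(2) C(2) insepC] by blast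
    then have "clique B" using assms[OF C(1)] by (auto simp: block_graph_def)
    then have "u \<rightarrow>\<^bsub>B\<^esub> w" using B uw(2) by (auto simp: clique_def complete_digraph_def)
    moreover have "subgraph B (G \<restriction> ?C)"
      using B(1) by (simp add: blocks_def pre_digraph.max_subgraph_def)
    ultimately have "u \<rightarrow>\<^bsub>G \<restriction> ?C\<^esub> w" using arcs_ends_mono by blast
    then show False using uw(3) by (simp add: adj_induce_iff)
  qed
qed

text \<open>Every face contains the empty set, so the shelling of \<open>facets_over\<close> with
  \<open>D = {}\<close> runs through all facets.\<close>

theorem shellable_Ind:
  assumes "\<And>H. H \<in> sccs \<Longrightarrow> block_graph H"
  shows "shellable (Ind r G)"
proof -
  have "adj.separable (verts G)" by (rule block_graphs_imp_separable) (rule assms)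
  then obtain Fs where "shelling Fs" "set Fs = facets (Ind r G)"
    using adj.shelling_facets_over[OF finite_verts _ empty_subsetI, of r]
    unfolding facets_Ind by metis
  moreover have "finite F" if "F \<in> Ind r G" for F
    using that finite_subset[OF _ finite_verts] by (simp add: Ind_def r_independent_def)
  ultimately show ?thesis by (rule shellableI[rotated])
qed

end

theorem theorem4p15:
  fixes G :: "('a,'b) pre_digraph"
  assumes "graph G" and "T2_graph G"
  shows "shellable (Ind 4 G)"
proof (rule graph.shellable_Ind[OF assms(1)])
  fix H assume "H \<in> pre_digraph.sccs G"
  then have "connected_T2_graph H" using assms(2) unfolding T2_graph_def by (rule bspec[rotated])
  then show "block_graph H" unfolding connected_T2_graph_def by (elim conjE)
qed

end
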